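(* Let $\mathcal{D}=(\mathcal{P},\mathcal{B})$ be a $1$-$(v,k,\lambda)$ design such that $\mathrm{Aut}(\mathcal{D})$ acts transitively on the point set $\mathcal{P}$ and on the block set $\mathcal{B}$. Then $\mathrm{Aut}(\mathcal{D}_I)\cong \mathrm{Aut}(\mathcal{D})/S(I)$.
   Context: A $1$-$(v,k,\lambda)$ design $\mathcal{D}=(\mathcal{P},\mathcal{B})$ consists of a finite set $\mathcal{P}$ of $v$ points and a set $\mathcal{B}$ of $k$-element subsets of $\mathcal{P}$ (blocks) such that every point lies in exactly $\lambda\ge 1$ blocks. An automorphism of $\mathcal{D}$ is a permutation $f$ of $\mathcal{P}$ which maps blocks to blocks, i.e. $f(B)\in\mathcal{B}$ for all $B\in\mathcal{B}$; these form the group $\mathrm{Aut}(\mathcal{D})$. For a point $x$, let $B_1,\dots,B_\lambda$ be all the distinct blocks containing $x$ and put $I_x:=\bigcap_{i=1}^{\lambda}B_i$. Then $I_y=I_x$ for all $y\in I_x$, so the distinct sets $I_{x_1},\dots,I_{x_t}$ partition $\mathcal{P}$; under the transitivity hypothesis they all have the same size. For a point $x$ and $\sigma$ in the symmetric group $S_{I_x}$ on the set $I_x$, let $\widetilde{\sigma}$ be the permutation of $\mathcal{P}$ acting as $\sigma$ on $I_x$ and fixing every point outside $I_x$; put $\widetilde{S}_{I_x}:=\{\widetilde\sigma:\sigma\in S_{I_x}\}$. Define $S(I):=\widetilde{S}_{I_{x_1}}\times\dots\times\widetilde{S}_{I_{x_t}}$ (internal direct product inside the symmetric group on $\mathcal{P}$);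 it is a normal subgroup of $\mathrm{Aut}(\mathcal{D})$. $\mathcal{D}_I=(\mathcal{P}_I,\mathcal{B}_I)$ is the $1$-$(v/|I_x|,k/|I_x|,\lambda)$ design with $\mathcal{P}_I:=\{I_{x_i}: 1\le i\le t\}$ and $\mathcal{B}_I:=\{\bar B: B\in\mathcal{B}\}$, where $\bar B=\{I_{x_i}: I_{x_i}\subset B\}$ (it is called the reduced design of $\mathcal{D}$ when $|I_x|>1$). *)

theory Defs
  imports "HOL-Algebra.Algebra"
begin

text \<open>A 1-(v, k, r) design; the number of blocks through a point is called r, as lambda is reserved.\<close>

locale one_design =
  fixes P :: "'a set" and \<B> :: "'a set set" and v k r :: nat
  assumes finite_points: "finite P"
    and card_points: "card P = v"
    and block_subset: "B \<in> \<B> \<Longrightarrow> B \<subseteq> P"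
    and card_block: "B \<in> \<B> \<Longrightarrow> card B = k"
    and index_pos: "r \<ge> 1"
    and point_index: "x \<in> P \<Longrightarrow> card {B \<in> \<B>. x \<in> B} = r"

text \<open>As in \<^const>\<open>BijGroup\<close>, permutations of a set are extensional functions, taking the value
  \<^const>\<open>undefined\<close> outside that set.\<close>

definition design_auts :: "'a set \<Rightarrow> 'a set set \<Rightarrow> ('a \<Rightarrow> 'a) set" where
  "design_auts P \<B> = {f \<in> Bij P. \<forall>B\<in>\<B>. f ` B \<in> \<B>}"

definition Aut_design :: "'a set \<Rightarrow> 'a set set \<Rightarrow> ('a \<Rightarrow> 'a) monoid" where
  "Aut_design P \<B> = (BijGroup P)\<lparr>carrier := design_auts P \<B>\<rparr>"

definition point_transitive :: "'a set \<Rightarrow> 'a set set \<Rightarrow> bool" where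
  "point_transitive P \<B> \<longleftrightarrow> transitive_action (Aut_design P \<B>) P (\<lambda>f. f)"

definition block_transitive :: "'a set \<Rightarrow> 'a set set \<Rightarrow> bool" where
  "block_transitive P \<B> \<longleftrightarrow> transitive_action (Aut_design P \<B>) \<B> (\<lambda>f. \<lambda>B\<in>\<B>. f ` B)"

definition I_set :: "'a set set \<Rightarrow> 'a \<Rightarrow> 'a set" where
  "I_set \<B> x = \<Inter>{B \<in> \<B>. x \<in> B}"

definition I_points :: "'a set \<Rightarrow> 'a set set \<Rightarrow> 'a set set" where
  "I_points P \<B> = I_set \<B> ` P"

definition I_blocks :: "'a set \<Rightarrow> 'a set set \<Rightarrow> 'a set set set" where
  "I_blocks P \<B> = (\<lambda>B. {J \<in> I_points P \<B>. J \<subseteq> B}) ` \<B>"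

definition extend_perm :: "'a set \<Rightarrow> 'a set \<Rightarrow> ('a \<Rightarrow> 'a) \<Rightarrow> 'a \<Rightarrow> 'a" where
  "extend_perm P J \<sigma> = (\<lambda>y\<in>P. if y \<in> J then \<sigma> y else y)"

definition S_tilde :: "'a set \<Rightarrow> 'a set \<Rightarrow> ('a \<Rightarrow> 'a) set" where
  "S_tilde P J = extend_perm P J ` carrier (BijGroup J)"

text \<open>For a design, the sets in \<^term>\<open>I_points P \<B>\<close> are pairwise disjoint, so the factors
  \<^term>\<open>S_tilde P J\<close> commute elementwise and each meets the product of the others trivially; their
  internal direct product is therefore the subgroup they generate.\<close>

definition S_I :: "'a set \<Rightarrow> 'a set set \<Rightarrow> ('a \<Rightarrow> 'a) set" where
  "S_I P \<B> = generate (BijGroup P) (\<Union>J \<in> I_points P \<B>. S_tilde P J)"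

text \<open>The two maps in the transitivity predicates are always actions, so \<^const>\<open>transitive_action\<close>
  adds nothing beyond the existence of the required automorphisms.\<close>

context one_design
begin

lemma finite_blocks: "finite \<B>"
  by (rule finite_subset[of _ "Pow P"]) (use block_subset finite_points in auto)

lemma design_aut_image_blocks:
  assumes "f \<in> design_auts P \<B>"
  shows "bij_betw (image f) \<B> \<B>"
proof -
  have f: "inj_on f P" "\<And>B. B \<in> \<B> \<Longrightarrow> f ` B \<in> \<B>"
    using assms by (auto simp: design_auts_def Bij_def bij_betw_def)
  have "inj_on (image f) \<B>"
    by (rule inj_onI) (metis block_subset f(1) inj_on_image_eq_iff)
  moreover have "image f ` \<B> \<subseteq> \<B>" using f(2) by auto
  ultimately show ?thesis
    by (simp add: bij_betw_def endo_inj_surj finite_blocks)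
qed

lemma subgroup_design_auts: "subgroup (design_auts P \<B>) (BijGroup P)"
proof (rule group.subgroupI[OF group_BijGroup])
  show "design_auts P \<B> \<subseteq> carrier (BijGroup P)"
    by (auto simp: design_auts_def BijGroup_def)
  have "(\<lambda>x\<in>P. x) ` B = B" if "B \<in> \<B>" for B
    using block_subset[OF that] by force
  then have "(\<lambda>x\<in>P. x) \<in> design_auts P \<B>"
    by (simp add: design_auts_def id_Bij)
  then show "design_auts P \<B> \<noteq> {}" by auto
next
  fix f assume f: "f \<in> design_auts P \<B>"
  then have fB: "f \<in> Bij P" by (simp add: design_auts_def)
  have "(\<lambda>x\<in>P. inv_into P f x) ` B \<in> \<B>" if B: "B \<in> \<B>" for B
  proof -
    obtain C where C: "C \<in> \<B>" "B = f ` C"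
      using bij_betw_imp_surj_on[OF design_aut_image_blocks[OF f]] B by blast
    have "(\<lambda>x\<in>P. inv_into P f x) ` B = inv_into P f ` f ` C"
      using C block_subset[OF B] by (auto intro!: image_cong)
    also have "\<dots> = C"
      using fB block_subset[OF C(1)] by (simp add: Bij_def bij_betw_def)
    finally show ?thesis using C by simp
  qed
  then show "inv\<^bsub>BijGroup P\<^esub> f \<in> design_auts P \<B>"
    using fB by (simp add: inv_BijGroup design_auts_def restrict_inv_into_Bij)
next
  fix f g assume fg: "f \<in> design_auts P \<B>" "g \<in> design_auts P \<B>"
  then have "compose P f g ` B = f ` g ` B" if "B \<in> \<B>" for B
    using block_subset[OF that] by (force simp: compose_def)
  then show "f \<otimes>\<^bsub>BijGroup P\<^esub> g \<in> design_auts P \<B>"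
    using fg by (auto simp: BijGroup_def design_auts_def compose_Bij)
qed

lemma group_Aut_design: "group (Aut_design P \<B>)"
  unfolding Aut_design_def
  by (rule group.subgroup_imp_group[OF group_BijGroup subgroup_design_auts])

lemma group_action_points: "group_action (Aut_design P \<B>) P (\<lambda>f. f)"
  using group_Aut_design group_BijGroup subgroup.subset[OF subgroup_design_auts]
  by (auto simp: group_action_def group_hom_def group_hom_axioms_def hom_def Aut_design_def)

lemma group_action_blocks: "group_action (Aut_design P \<B>) \<B> (\<lambda>f. \<lambda>B\<in>\<B>. f ` B)"
proof -
  have a: "(\<lambda>B\<in>\<B>. f ` B) \<in> Bij \<B>" if "f \<in> design_auts P \<B>" for f
    using design_aut_image_blocks[OF that] by (simp add: Bij_def cong: bij_betw_cong)
  have b: "(\<lambda>B\<in>\<B>. compose P f g ` B) = compose \<B> (\<lambda>B\<in>\<B>. f ` B) (\<lambda>B\<in>\<B>. g ` B)"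
    if "f \<in> design_auts P \<B>" "g \<in> design_auts P \<B>" for f g
  proof
    fix B
    show "(\<lambda>B\<in>\<B>. compose P f g ` B) B = compose \<B> (\<lambda>B\<in>\<B>. f ` B) (\<lambda>B\<in>\<B>. g ` B) B"
    proof (cases "B \<in> \<B>")
      case True
      then have "compose P f g ` B = f ` g ` B"
        using block_subset[OF True] by (force simp: compose_def)
      then show ?thesis using True that by (simp add: compose_def design_auts_def)
    qed (simp add: compose_def)
  qed
  have c: "f \<in> Bij P" if "f \<in> design_auts P \<B>" for f
    using that by (simp add: design_auts_def)
  show ?thesis
    using group_Aut_design group_BijGroup a b c
    by (auto simp: group_action_def group_hom_def group_hom_axioms_def hom_def Aut_design_def
        BijGroup_def)
qed

lemma point_transitive_iff:
  "point_transitive P \<B> \<longleftrightarrow> (\<forall>x\<in>P. \<forall>y\<in>P. \<exists>f\<in>design_auts P \<B>. f x = y)"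
  using group_action_points
  by (auto simp: point_transitive_def transitive_action_def transitive_action_axioms_def
      Aut_design_def)

lemma block_transitive_iff:
  "block_transitive P \<B> \<longleftrightarrow> (\<forall>B\<in>\<B>. \<forall>C\<in>\<B>. \<exists>f\<in>design_auts P \<B>. f ` B = C)"
  using group_action_blocks
  by (auto simp: block_transitive_def transitive_action_def transitive_action_axioms_def
      Aut_design_def)

end

end

theory Submission
  imports Defs
begin

text \<open>An automorphism \<open>f\<close> of the design permutes the blocks, hence carries the intersection of the
  blocks through \<open>x\<close> onto the intersection of the blocks through \<open>f x\<close>.  It therefore permutes the
  cells \<open>I_set \<B> x\<close>, which partition the point set, and since every block is a union of cells this
  permutation of cells is an automorphism of the design \<open>I_points P \<B>\<close>, \<open>I_blocks P \<B>\<close>.  The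
  theorem is the first isomorphism theorem for the resulting homomorphism \<open>cell_action\<close>.

  It is onto (\<open>cell_action_surj\<close>) because transitivity on the points makes all cells equally large:
  a permutation \<open>g\<close> of the cells lifts to a permutation of the points by gluing arbitrary bijections
  from each cell \<open>J\<close> to \<open>g J\<close>, and the lift maps blocks to blocks if \<open>g\<close> does, again because blocks
  are unions of cells.

  Its kernel consists of the automorphisms that stabilise every cell.  Any permutation of the
  points that stabilises every cell is a product of its finitely many restrictions to the single
  cells, so it lies in \<open>S_I P \<B>\<close>; conversely each generator of \<open>S_I P \<B>\<close> stabilises every cell
  and therefore every block (\<open>kernel_cell_action\<close>).\<close>

section \<open>The partition of the points into cells\<close>

lemma self_mem_I_set: "x \<in> I_set \<B> x"
  by (simp add: I_set_def)

context one_design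
begin

abbreviation cells :: "'a set set" where
  "cells \<equiv> I_points P \<B>"

text \<open>The block that \<open>B\<close> induces in the design of cells.\<close>

abbreviation cells_in :: "'a set \<Rightarrow> 'a set set" where
  "cells_in B \<equiv> {J \<in> cells. J \<subseteq> B}"

lemma block_through_point:
  assumes "x \<in> P"
  obtains B where "B \<in> \<B>" "x \<in> B"
proof -
  have "{B \<in> \<B>. x \<in> B} \<noteq> {}"
    using point_index[OF assms] index_pos by (metis card.empty not_one_le_zero)
  then show ?thesis using that by blast
qed

lemma I_set_subset_points: "x \<in> P \<Longrightarrow> I_set \<B> x \<subseteq> P"
  by (rule block_through_point) (auto simp: I_set_def dest: block_subset)

lemma I_set_subset_block_iff: "B \<in> \<B> \<Longrightarrow> I_set \<B> x \<subseteq> B \<longleftrightarrow> x \<in> B"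
  by (auto simp: I_set_def)

text \<open>All blocks through \<open>x\<close> pass through each \<open>y\<close> in its cell; as equally many blocks pass through
  both points, these are the same blocks.\<close>

lemma I_set_eq:
  assumes x: "x \<in> P" and y: "y \<in> I_set \<B> x"
  shows "I_set \<B> y = I_set \<B> x"
proof -
  have "y \<in> P" using I_set_subset_points x y by blast
  moreover have "{B \<in> \<B>. x \<in> B} \<subseteq> {B \<in> \<B>. y \<in> B}"
    using y by (auto simp: I_set_def)
  ultimately have "{B \<in> \<B>. x \<in> B} = {B \<in> \<B>. y \<in> B}"
    using finite_blocks x by (intro card_subset_eq) (simp_all add: point_index)
  then show ?thesis by (simp add: I_set_def)
qed

lemma cell_eq_I_set:
  assumes "J \<in> cells" "x \<in> J"
  shows "J = I_set \<B> x"
proof -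
  obtain y where "y \<in> P" "J = I_set \<B> y"
    using assms(1) unfolding I_points_def by (rule imageE)
  then show ?thesis using I_set_eq assms(2) by simp
qed

lemma cell_nonempty: "J \<in> cells \<Longrightarrow> J \<noteq> {}"
  unfolding I_points_def by (erule imageE) (auto simp: I_set_def)

lemma cell_subset_points: "J \<in> cells \<Longrightarrow> J \<subseteq> P"
  unfolding I_points_def by (erule imageE) (simp add: I_set_subset_points)

lemma Union_cells: "\<Union>cells = P"
proof
  show "\<Union>cells \<subseteq> P" using cell_subset_points by blast
  show "P \<subseteq> \<Union>cells"
  proof
    fix x assume "x \<in> P"
    then show "x \<in> \<Union>cells"
      unfolding I_points_def using self_mem_I_set by (rule UN_I)
  qed
qed

lemma finite_cells: "finite cells"
  by (simp add: I_points_def finite_points)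

lemma cells_disjoint:
  assumes "J \<in> cells" "K \<in> cells" "J \<noteq> K"
  shows "J \<inter> K = {}"
proof (rule equals0I)
  fix x assume "x \<in> J \<inter> K"
  then have x: "x \<in> J" "x \<in> K" by simp_all
  have "J = I_set \<B> x" by (rule cell_eq_I_set[OF assms(1) x(1)])
  also have "\<dots> = K" by (rule cell_eq_I_set[OF assms(2) x(2), symmetric])
  finally show False using assms(3) by simp
qed

lemma Union_cells_in: "B \<in> \<B> \<Longrightarrow> \<Union>(cells_in B) = B"
proof -
  assume B: "B \<in> \<B>"
  have "x \<in> \<Union>(cells_in B)" if "x \<in> B" for x
  proof -
    have "I_set \<B> x \<in> cells_in B"
      using I_set_subset_block_iff[OF B] block_subset[OF B] that by (auto simp: I_points_def)
    then show ?thesis using self_mem_I_set by (rule UnionI)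
  qed
  then show ?thesis by blast
qed

lemma inj_on_cells_in: "inj_on cells_in \<B>"
proof (rule inj_onI)
  fix B C assume BC: "B \<in> \<B>" "C \<in> \<B>" "cells_in B = cells_in C"
  have "B = \<Union>(cells_in B)" by (rule Union_cells_in[OF BC(1), symmetric])
  also have "\<dots> = C" unfolding BC(3) by (rule Union_cells_in[OF BC(2)])
  finally show "B = C" .
qed

section \<open>The action of automorphisms on cells\<close>

lemma aut_Bij: "f \<in> design_auts P \<B> \<Longrightarrow> f \<in> Bij P"
  by (simp add: design_auts_def)

lemma Bij_inj_on: "f \<in> Bij A \<Longrightarrow> inj_on f A"
  and Bij_mem: "f \<in> Bij A \<Longrightarrow> x \<in> A \<Longrightarrow> f x \<in> A"
  by (auto simp: Bij_def bij_betw_def)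

text \<open>An automorphism maps the blocks through \<open>x\<close> bijectively to the blocks through \<open>f x\<close>, and
  its injectivity on the points lets images commute with the intersection of these blocks.\<close>

lemma aut_image_I_set:
  assumes f: "f \<in> design_auts P \<B>" and x: "x \<in> P"
  shows "f ` I_set \<B> x = I_set \<B> (f x)"
proof -
  have inj: "inj_on f P" using f aut_Bij Bij_inj_on by blast
  have "image f ` {B \<in> \<B>. x \<in> B} = {B \<in> \<B>. f x \<in> B}"
  proof (intro equalityI subsetI)
    fix C assume C: "C \<in> {B \<in> \<B>. f x \<in> B}"
    then obtain B where B: "B \<in> \<B>" "C = f ` B"
      using bij_betw_imp_surj_on[OF design_aut_image_blocks[OF f]] by blast
    have "x \<in> B"
      using C B inj x block_subset[OF B(1)] by (auto dest: inj_onD)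
    then show "C \<in> image f ` {B \<in> \<B>. x \<in> B}" using B by blast
  qed (use f in \<open>auto simp: design_auts_def\<close>)
  moreover obtain B where "B \<in> {B \<in> \<B>. x \<in> B}"
    using block_through_point[OF x] by blast
  ultimately show ?thesis
    using image_INT[OF inj, of "{B \<in> \<B>. x \<in> B}" "\<lambda>B. B" B] block_subset
    by (simp add: I_set_def)
qed

lemma aut_image_cell:
  assumes "f \<in> design_auts P \<B>" "J \<in> cells"
  shows "f ` J \<in> cells"
proof -
  obtain x where x: "x \<in> P" "J = I_set \<B> x"
    using assms(2) unfolding I_points_def by (rule imageE)
  then have "f ` J = I_set \<B> (f x)"
    using aut_image_I_set[OF assms(1) x(1)] by simp
  then show ?thesis
    using Bij_mem[OF aut_Bij[OF assms(1)] x(1)] by (simp add: I_points_def)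
qed

definition cell_action :: "('a \<Rightarrow> 'a) \<Rightarrow> 'a set \<Rightarrow> 'a set" where
  "cell_action f = (\<lambda>J\<in>cells. f ` J)"

lemma image_permutes_cells:
  assumes f: "inj_on f P" "\<And>J. J \<in> cells \<Longrightarrow> f ` J \<in> cells"
  shows "bij_betw (image f) cells cells"
proof -
  have "inj_on (image f) cells"
    by (rule inj_onI) (metis cell_subset_points f(1) inj_on_image_eq_iff)
  then show ?thesis
    using f(2) finite_cells by (simp add: bij_betw_def endo_inj_surj image_subsetI)
qed

lemma image_cells_in:
  assumes "B \<in> \<B>"
    and f: "inj_on f P" "\<And>J. J \<in> cells \<Longrightarrow> f ` J \<in> cells"
  shows "image f ` cells_in B = cells_in (f ` B)"
proof -
  have onto: "image f ` cells = cells"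
    by (rule bij_betw_imp_surj_on[OF image_permutes_cells[OF f]])
  have iff: "f ` J \<subseteq> f ` B \<longleftrightarrow> J \<subseteq> B" if "J \<in> cells" for J
    using f(1) cell_subset_points[OF that] block_subset[OF assms(1)] by (fastforce dest: inj_onD)
  have "cells_in (f ` B) = {K \<in> image f ` cells. K \<subseteq> f ` B}"
    by (simp add: onto)
  also have "\<dots> = image f ` cells_in B"
    using iff by blast
  finally show ?thesis ..
qed

lemma cell_action_Bij:
  assumes f: "f \<in> design_auts P \<B>"
  shows "cell_action f \<in> Bij cells"
proof -
  have "bij_betw (image f) cells cells"
    by (rule image_permutes_cells[OF Bij_inj_on[OF aut_Bij[OF f]] aut_image_cell[OF f]])
  then show ?thesis by (simp add: cell_action_def Bij_def cong: bij_betw_cong)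
qed

lemma cells_in_mem_I_blocks: "B \<in> \<B> \<Longrightarrow> cells_in B \<in> I_blocks P \<B>"
  unfolding I_blocks_def by (rule imageI)

lemma I_blocksE:
  assumes "C \<in> I_blocks P \<B>"
  obtains B where "B \<in> \<B>" "C = cells_in B"
  by (rule imageE[OF assms[unfolded I_blocks_def]]) (rule that)

lemma cell_action_aut:
  assumes f: "f \<in> design_auts P \<B>"
  shows "cell_action f \<in> design_auts cells (I_blocks P \<B>)"
proof -
  have "cell_action f ` C \<in> I_blocks P \<B>" if C: "C \<in> I_blocks P \<B>" for C
  proof -
    obtain B where B: "B \<in> \<B>" "C = cells_in B"
      using C by (rule I_blocksE)
    have "cell_action f ` C = image f ` cells_in B"
      unfolding B(2) by (rule image_cong) (simp_all add: cell_action_def)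
    also have "\<dots> = cells_in (f ` B)"
      using image_cells_in[OF B(1) Bij_inj_on[OF aut_Bij[OF f]] aut_image_cell[OF f]] .
    also have "\<dots> \<in> I_blocks P \<B>"
      using f B(1) by (intro cells_in_mem_I_blocks) (simp add: design_auts_def)
    finally show ?thesis .
  qed
  then show ?thesis
    using cell_action_Bij[OF f] by (simp add: design_auts_def)
qed

lemma cell_action_compose:
  assumes g: "g \<in> design_auts P \<B>"
  shows "cell_action (compose P f g) = compose cells (cell_action f) (cell_action g)"
proof
  fix J
  show "cell_action (compose P f g) J = compose cells (cell_action f) (cell_action g) J"
  proof (cases "J \<in> cells")
    case True
    then have "compose P f g ` J = f ` g ` J"
      using cell_subset_points by (force simp: compose_def)
    then show ?thesis
      using True aut_image_cell[OF g] by (simp add: compose_def cell_action_def)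
  qed (simp add: compose_def cell_action_def)
qed

section \<open>The design of cells\<close>

lemma card_cells_equal:
  assumes "point_transitive P \<B>" "J \<in> cells" "K \<in> cells"
  shows "card J = card K"
proof -
  obtain x y where xy: "x \<in> P" "J = I_set \<B> x" "y \<in> P" "K = I_set \<B> y"
    using assms by (auto simp: I_points_def)
  then obtain f where f: "f \<in> design_auts P \<B>" "f x = y"
    using assms(1) point_transitive_iff by blast
  have "K = f ` J" using aut_image_I_set[OF f(1)] xy f by simp
  moreover have "inj_on f J"
    using Bij_inj_on[OF aut_Bij[OF f(1)]] cell_subset_points[OF assms(2)] inj_on_subset by blast
  ultimately show ?thesis by (simp add: card_image)
qed

text \<open>Points and blocks are counted with the common size \<open>m\<close> of the cells; the blocks through a cell
  correspond to the blocks through any of its points.  Without points no \<open>m\<close> is determined, and then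
  any value will do, as every block is empty.\<close>

lemma one_design_cells:
  assumes "point_transitive P \<B>"
  obtains v' k' where "one_design cells (I_blocks P \<B>) v' k' r"
proof -
  obtain m where m: "card J = m" if "J \<in> cells" for J
  proof (cases "cells = {}")
    case False
    then obtain K where "K \<in> cells" by blast
    then show ?thesis using that card_cells_equal[OF assms] by blast
  qed (use that in simp)
  have count: "m * card (cells_in B) = k" if B: "B \<in> \<B>" for B
  proof -
    have "m * card (cells_in B) = card (\<Union>(cells_in B))"
    proof (rule card_partition)
      show "finite (\<Union>(cells_in B))"
        unfolding Union_cells_in[OF B] using block_subset[OF B] finite_points by (rule finite_subset)
    qed (simp_all add: finite_cells m cells_disjoint)
    then show ?thesis using Union_cells_in[OF B] card_block[OF B] by simp
  qed
  have "one_design cells (I_blocks P \<B>) (card cells) (k div m) r"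
  proof
    show "finite cells" by (rule finite_cells)
    show "card cells = card cells" ..
    show "r \<ge> 1" by (rule index_pos)
  next
    fix C assume "C \<in> I_blocks P \<B>"
    then obtain B where B: "B \<in> \<B>" "C = cells_in B"
      by (rule I_blocksE)
    then show "C \<subseteq> cells" by blast
    show "card C = k div m"
    proof (cases "C = {}")
      case True
      then have "k = 0" using count[OF B(1)] B(2) by (metis card.empty mult_0_right)
      then show ?thesis using True by simp
    next
      case False
      then obtain J where "J \<in> cells" using B(2) by blast
      have "finite J"
        using cell_subset_points[OF \<open>J \<in> cells\<close>] finite_points by (rule finite_subset)
      moreover have "J \<noteq> {}" by (rule cell_nonempty[OF \<open>J \<in> cells\<close>])
      ultimately have "m > 0" using m[OF \<open>J \<in> cells\<close>] card_gt_0_iff[of J] by simp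
      then show ?thesis using count[OF B(1)] B(2) by auto
    qed
  next
    fix J assume "J \<in> cells"
    then obtain x where x: "x \<in> P" "J = I_set \<B> x" by (auto simp: I_points_def)
    then have "{C \<in> I_blocks P \<B>. J \<in> C} = cells_in ` {B \<in> \<B>. x \<in> B}"
      using I_set_subset_block_iff \<open>J \<in> cells\<close> by (auto simp: I_blocks_def)
    moreover have "inj_on cells_in {B \<in> \<B>. x \<in> B}"
      using inj_on_cells_in by (rule inj_on_subset) blast
    ultimately show "card {C \<in> I_blocks P \<B>. J \<in> C} = r"
      using point_index[OF x(1)] by (simp add: card_image)
  qed
  then show ?thesis by (rule that)
qed

section \<open>Lifting automorphisms of the design of cells\<close>

lemma carrier_Aut_design: "carrier (Aut_design A \<C>) = design_auts A \<C>"
  and one_Aut_design: "\<one>\<^bsub>Aut_design A \<C>\<^esub> = (\<lambda>x\<in>A. x)"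
  by (simp_all add: Aut_design_def BijGroup_def)

lemma mult_Aut_design:
  "f \<in> design_auts A \<C> \<Longrightarrow> g \<in> design_auts A \<C> \<Longrightarrow> f \<otimes>\<^bsub>Aut_design A \<C>\<^esub> g = compose A f g"
  by (simp add: Aut_design_def BijGroup_def design_auts_def)

lemma group_hom_cell_action:
  assumes "point_transitive P \<B>"
  shows "group_hom (Aut_design P \<B>) (Aut_design cells (I_blocks P \<B>)) cell_action"
proof -
  obtain v' k' where "one_design cells (I_blocks P \<B>) v' k' r"
    using one_design_cells[OF assms] .
  then have "group (Aut_design cells (I_blocks P \<B>))"
    by (rule one_design.group_Aut_design)
  moreover have "cell_action \<in> hom (Aut_design P \<B>) (Aut_design cells (I_blocks P \<B>))"
    by (rule homI)
      (simp_all add: carrier_Aut_design cell_action_aut mult_Aut_design cell_action_compose)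
  ultimately show ?thesis
    using group_Aut_design by (simp add: group_hom_def group_hom_axioms_def)
qed

text \<open>A permutation of the cells lifts to the points because the cells are equally large, which is
  what transitivity on the points provides.\<close>

lemma cell_action_surj:
  assumes "point_transitive P \<B>"
  shows "cell_action ` design_auts P \<B> = design_auts cells (I_blocks P \<B>)"
proof (intro equalityI subsetI)
  fix g assume "g \<in> design_auts cells (I_blocks P \<B>)"
  then have gB: "g \<in> Bij cells" and gI: "\<And>C. C \<in> I_blocks P \<B> \<Longrightarrow> g ` C \<in> I_blocks P \<B>"
    by (auto simp: design_auts_def)
  have g_cell: "g J \<in> cells" if "J \<in> cells" for J
    using Bij_mem[OF gB that] .
  have "\<exists>h. bij_betw h J (g J)" if J: "J \<in> cells" for J
  proof (rule finite_same_card_bij)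
    show "finite J" "finite (g J)"
      using cell_subset_points J g_cell finite_points finite_subset by metis+
    show "card J = card (g J)"
      by (rule card_cells_equal[OF assms J g_cell[OF J]])
  qed
  then obtain h where h: "bij_betw (h J) J (g J)" if "J \<in> cells" for J
    by metis
  \<comment> \<open>the bijections of the single cells, glued along the partition\<close>
  define f where "f = (\<lambda>x\<in>P. h (I_set \<B> x) x)"
  have f_h: "f x = h J x" if "J \<in> cells" "x \<in> J" for J x
    using that cell_eq_I_set cell_subset_points by (auto simp: f_def)
  have f_cell: "f ` J = g J" if J: "J \<in> cells" for J
    using f_h[OF J] bij_betw_imp_surj_on[OF h[OF J]] by (simp cong: image_cong)
  have "f ` P = P"
  proof -
    have "f ` P = \<Union>(image f ` cells)"
      using Union_cells by blast
    also have "\<dots> = \<Union>(g ` cells)" using f_cell by simp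
    also have "\<dots> = P" using gB Union_cells by (simp add: Bij_def bij_betw_def)
    finally show ?thesis .
  qed
  then have fB: "f \<in> Bij P"
    using finite_points by (simp add: Bij_def bij_betw_def finite_surj_inj f_def)
  have "f ` B \<in> \<B>" if B: "B \<in> \<B>" for B
  proof -
    obtain C where C: "C \<in> \<B>" "g ` cells_in B = cells_in C"
      using gI[OF cells_in_mem_I_blocks[OF B]] by (rule I_blocksE)
    have "f ` B = \<Union>(image f ` cells_in B)"
      using Union_cells_in[OF B] by (metis image_Union)
    also have "image f ` cells_in B = g ` cells_in B"
      using f_cell by (intro image_cong) auto
    also have "\<Union>(g ` cells_in B) = C"
      by (simp only: C(2) Union_cells_in[OF C(1)])
    finally show ?thesis using C(1) by simp
  qed
  then have "f \<in> design_auts P \<B>"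
    using fB by (simp add: design_auts_def)
  moreover have "cell_action f = g"
    using gB f_cell by (auto simp: cell_action_def Bij_def extensional_def fun_eq_iff)
  ultimately show "g \<in> cell_action ` design_auts P \<B>" by blast
qed (use cell_action_aut in auto)

section \<open>The kernel: automorphisms stabilising every cell\<close>

lemma stabilises_cells_imp_Bij:
  assumes "f \<in> extensional P" "\<And>J. J \<in> cells \<Longrightarrow> f ` J = J"
  shows "f \<in> Bij P"
proof -
  have "f ` P = \<Union>(image f ` cells)"
    using Union_cells by blast
  also have "\<dots> = P"
    using assms(2) Union_cells by simp
  finally show ?thesis
    using assms(1) finite_points by (simp add: Bij_def bij_betw_def finite_surj_inj)
qed

text \<open>Blocks are unions of cells, so a permutation that stabilises every cell stabilises every
  block.\<close>

lemma stabilises_cells_imp_aut: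
  assumes f: "f \<in> Bij P" "\<And>J. J \<in> cells \<Longrightarrow> f ` J = J"
  shows "f \<in> design_auts P \<B>"
proof -
  have "f ` B = B" if B: "B \<in> \<B>" for B
  proof -
    have "f ` B = \<Union>(image f ` cells_in B)"
      using Union_cells_in[OF B] by (metis image_Union)
    also have "image f ` cells_in B = cells_in B"
      using f(2) by simp
    finally show ?thesis using Union_cells_in[OF B] by simp
  qed
  then show ?thesis using f(1) by (simp add: design_auts_def)
qed

lemma kernel_cell_action_eq:
  "kernel (Aut_design P \<B>) (Aut_design cells (I_blocks P \<B>)) cell_action =
    {f \<in> Bij P. \<forall>J\<in>cells. f ` J = J}"
proof -
  have "cell_action f = (\<lambda>J\<in>cells. J) \<longleftrightarrow> (\<forall>J\<in>cells. f ` J = J)" for f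
    by (auto simp: cell_action_def restrict_def fun_eq_iff)
  then show ?thesis
    using stabilises_cells_imp_aut aut_Bij
    by (auto simp: kernel_def carrier_Aut_design one_Aut_design)
qed

lemma extend_perm_image:
  assumes "J \<in> cells" "K \<in> cells" "\<sigma> ` J = J"
  shows "extend_perm P J \<sigma> ` K = K"
proof (cases "K = J")
  case True
  then have "extend_perm P J \<sigma> ` K = \<sigma> ` J"
    using cell_subset_points[OF assms(1)] by (auto simp: extend_perm_def intro!: image_cong)
  then show ?thesis using True assms(3) by simp
next
  case False
  then have "extend_perm P J \<sigma> ` K = id ` K"
    using cells_disjoint[OF assms(1,2)] cell_subset_points[OF assms(2)]
    by (intro image_cong) (auto simp: extend_perm_def)
  then show ?thesis by simp
qed

lemma extend_perm_Bij:
  assumes "J \<in> cells" "\<sigma> ` J = J"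
  shows "extend_perm P J \<sigma> \<in> Bij P"
proof (rule stabilises_cells_imp_Bij)
  show "extend_perm P J \<sigma> \<in> extensional P" by (simp add: extend_perm_def)
qed (rule extend_perm_image[OF assms(1) _ assms(2)])

text \<open>Peeling off one cell at a time: a permutation \<open>f\<close> that moves only points of the cells in
  \<open>insert J F\<close> is the product of its restriction to \<open>J\<close> and of a permutation that moves only
  points of the cells in \<open>F\<close>.\<close>

lemma stabilises_cells_imp_in_S_I:
  assumes "finite F" "F \<subseteq> cells" "f \<in> Bij P" "\<And>J. J \<in> cells \<Longrightarrow> f ` J = J"
    and "\<And>x. x \<in> P - \<Union>F \<Longrightarrow> f x = x"
  shows "f \<in> S_I P \<B>"
  using assms
proof (induction F arbitrary: f rule: finite_induct)
  case empty
  then have "f = \<one>\<^bsub>BijGroup P\<^esub>"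
    by (auto simp: BijGroup_def Bij_def extensional_def)
  then show ?case by (simp add: S_I_def generate.one)
next
  case (insert J F)
  then have J: "J \<in> cells" "f ` J = J" by auto
  define s where "s = extend_perm P J (restrict f J)"
  define f' where "f' = (\<lambda>x\<in>P. if x \<in> J then x else f x)"
  have "restrict f J \<in> carrier (BijGroup J)"
    using J Bij_inj_on[OF insert.prems(2)] cell_subset_points
    by (auto simp: BijGroup_def Bij_def bij_betw_def intro: inj_on_subset)
  then have s: "s \<in> S_I P \<B>"
    using J(1) unfolding s_def S_I_def S_tilde_def by (intro generate.incl) blast
  have "restrict f J ` J = J" using J(2) by simp
  then have sB: "s \<in> Bij P" unfolding s_def by (rule extend_perm_Bij[OF J(1)])
  have f'_cell: "f' ` K = K" if K: "K \<in> cells" for K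
  proof (cases "K = J")
    case True
    then show ?thesis using cell_subset_points[OF K] by (force simp: f'_def)
  next
    case False
    then have "f' ` K = f ` K"
      using cells_disjoint[OF K J(1)] cell_subset_points[OF K]
      by (intro image_cong) (auto simp: f'_def)
    then show ?thesis using insert.prems(3)[OF K] by simp
  qed
  have f'B: "f' \<in> Bij P"
    by (rule stabilises_cells_imp_Bij[OF _ f'_cell]) (simp add: f'_def)
  have f': "f' \<in> S_I P \<B>"
  proof (rule insert.IH)
    show "F \<subseteq> cells" using insert.prems(1) by simp
    show "f' x = x" if "x \<in> P - \<Union>F" for x
      using insert.prems(4)[of x] that by (simp add: f'_def)
  qed (fact f'B, fact f'_cell)
  \<comment> \<open>\<open>f'\<close> and \<open>f\<close> agree off \<open>J\<close> and map into the complement of \<open>J\<close> there, whose points \<open>s\<close> fixes\<close>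
  have "f = compose P s f'"
  proof
    fix x show "f x = compose P s f' x"
    proof (cases "x \<in> P")
      case True
      have "f x \<in> P" using Bij_mem[OF insert.prems(2) True] .
      moreover have "f x \<in> J \<longleftrightarrow> x \<in> J"
        using inj_on_image_mem_iff[OF Bij_inj_on[OF insert.prems(2)] True cell_subset_points[OF J(1)]]
        by (simp add: J(2))
      ultimately show ?thesis
        using True by (simp add: compose_def f'_def s_def extend_perm_def)
    qed (use insert.prems(2) in \<open>simp add: compose_def Bij_def extensional_def\<close>)
  qed
  also have "\<dots> = s \<otimes>\<^bsub>BijGroup P\<^esub> f'"
    using sB f'B by (simp add: BijGroup_def)
  also have "\<dots> \<in> S_I P \<B>"
    using s f' unfolding S_I_def by (rule generate.eng)
  finally show ?case .
qed

lemma kernel_cell_action: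
  assumes "point_transitive P \<B>"
  shows "kernel (Aut_design P \<B>) (Aut_design cells (I_blocks P \<B>)) cell_action = S_I P \<B>"
    (is "?K = _")
proof
  interpret group_hom "Aut_design P \<B>" "Aut_design cells (I_blocks P \<B>)" cell_action
    by (rule group_hom_cell_action[OF assms])
  show "?K \<subseteq> S_I P \<B>"
    using stabilises_cells_imp_in_S_I[OF finite_cells subset_refl] Union_cells
    by (auto simp: kernel_cell_action_eq)
  show "S_I P \<B> \<subseteq> ?K"
    unfolding S_I_def
  proof (rule group.generate_subgroup_incl[OF group_BijGroup])
    show "subgroup ?K (BijGroup P)"
      using group.incl_subgroup[OF group_BijGroup subgroup_design_auts] subgroup_kernel
      by (simp add: Aut_design_def)
    have "extend_perm P J \<sigma> \<in> ?K" if "J \<in> cells" "\<sigma> \<in> carrier (BijGroup J)" for J \<sigma>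
    proof -
      have "\<sigma> ` J = J" using that(2) by (simp add: BijGroup_def Bij_def bij_betw_def)
      then show ?thesis
        using that(1) by (simp add: kernel_cell_action_eq extend_perm_Bij extend_perm_image)
    qed
    then show "(\<Union>J\<in>cells. S_tilde P J) \<subseteq> ?K"
      unfolding S_tilde_def by blast
  qed
qed

end

theorem theorem2p12:
  fixes P :: "'a set" and \<B> :: "'a set set" and v k r :: nat
  assumes "one_design P \<B> v k r"
    and "point_transitive P \<B>"
    and "block_transitive P \<B>"
  shows "Aut_design (I_points P \<B>) (I_blocks P \<B>) \<cong> Aut_design P \<B> Mod S_I P \<B>"
proof -
  interpret one_design P \<B> v k r by (rule assms)
  interpret group_hom "Aut_design P \<B>" "Aut_design cells (I_blocks P \<B>)" cell_action
    by (rule group_hom_cell_action[OF assms(2)])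
  have "Aut_design P \<B> Mod S_I P \<B> \<cong> Aut_design cells (I_blocks P \<B>)"
    using FactGroup_iso cell_action_surj[OF assms(2)] kernel_cell_action[OF assms(2)]
    by (simp add: carrier_Aut_design)
  moreover have "group (Aut_design P \<B> Mod S_I P \<B>)"
    using normal.factorgroup_is_group[OF normal_kernel] kernel_cell_action[OF assms(2)] by simp
  ultimately show ?thesis by (rule group.iso_sym[rotated])
qed

end
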